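(* Let $0<a_1<a_2<a_3$ be integers with $\gcd(a_1,a_2)=1$, and let $b_{-1},b'_{-1},b_0,b'_0,\dots$ and $k$ be produced by the procedure described in the context, where it is assumed that $b_0>0$ (so that the iteration is started) and that the iteration halts after $k$ rounds. Then $$G(a_1,a_2,a_3)=\begin{cases} b_{k}a_1+b'_{k-1}a_2-\min(b_{k-1}a_1,\,b'_{k}a_2) & \text{if } k \text{ is odd},\\ b_{k-1}a_1+b'_{k}a_2-\min(b_{k}a_1,\,b'_{k-1}a_2) & \text{if } k \text{ is even}.\end{cases}$$
   Context: For positive integers $a_1,a_2,a_3$ with $\gcd(a_1,a_2,a_3)=1$, $G(a_1,a_2,a_3)$ denotes the largest integer that cannot be written as $a_1x_1+a_2x_2+a_3x_3$ with positive integers $x_1,x_2,x_3$. Procedure: set $b_{-1}=a_2$ and $b'_{-1}=a_1$. Let $b'_0,b_0$ be the unique integers with $0<b'_0\le a_1$ and $a_3=a_2b'_0-a_1b_0$. Assuming $b_0>0$, for $i=0,1,2,\dots$ do the following: if $b_i=0$ or $b'_i=0$, halt and set $k=i$. Otherwise let $q_i=\lfloor b_{i-1}/b_i\rfloor$, $q'_i=\lfloor b'_{i-1}/b'_i\rfloor$, $m_i=\min(q_i,q'_i)$, and define $b_{i+1}=b_{i-1}-m_ib_i$, $b'_{i+1}=b'_{i-1}-m_ib'_i$; if $q_i\neq q'_i$, halt and set $k=i+1$; otherwise continue with $i+1$. "The iteration halts after $k$ rounds" means it halts with this value of $k$. *)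

theory Defs
  imports Complex_Main
begin

definition positively_representable :: "int \<Rightarrow> int \<Rightarrow> int \<Rightarrow> int \<Rightarrow> bool" where
  "positively_representable a1 a2 a3 n \<longleftrightarrow>
     (\<exists>x1 x2 x3. x1 > 0 \<and> x2 > 0 \<and> x3 > 0 \<and> n = a1 * x1 + a2 * x2 + a3 * x3)"

text \<open>The coefficients are required to be positive, not merely nonnegative, so \<open>G\<close> exceeds
  the usual Frobenius number by \<open>a1 + a2 + a3\<close>.\<close>

definition G :: "int \<Rightarrow> int \<Rightarrow> int \<Rightarrow> int" where
  "G a1 a2 a3 = (GREATEST n. \<not> positively_representable a1 a2 a3 n)"

text \<open>The sequences \<open>b\<close> and \<open>b'\<close> are functions on the integers, so that the index \<open>-1\<close> is
  available. Only the values at \<open>-1, 0, \<dots>, k\<close> are produced by the procedure; all other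
  values are unconstrained.\<close>

definition initial_values ::
  "int \<Rightarrow> int \<Rightarrow> int \<Rightarrow> (int \<Rightarrow> int) \<Rightarrow> (int \<Rightarrow> int) \<Rightarrow> bool" where
  "initial_values a1 a2 a3 b b' \<longleftrightarrow>
     b (-1) = a2 \<and> b' (-1) = a1 \<and>
     0 < b' 0 \<and> b' 0 \<le> a1 \<and> a3 = a2 * b' 0 - a1 * b 0"

definition quotient :: "(int \<Rightarrow> int) \<Rightarrow> int \<Rightarrow> int" where
  "quotient c i = c (i - 1) div c i"

definition round_step :: "(int \<Rightarrow> int) \<Rightarrow> (int \<Rightarrow> int) \<Rightarrow> int \<Rightarrow> bool" where
  "round_step b b' i \<longleftrightarrow>
     b i \<noteq> 0 \<and> b' i \<noteq> 0 \<and>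
     (let m = min (quotient b i) (quotient b' i)
      in b (i + 1) = b (i - 1) - m * b i \<and> b' (i + 1) = b' (i - 1) - m * b' i)"

text \<open>The value \<open>k\<close> is reached either because the test for zero succeeds at index \<open>k\<close>, or
  because the quotients differ at index \<open>k - 1\<close>; the two universally quantified conditions say
  that neither test stopped the iteration earlier.\<close>

definition halts_after :: "(int \<Rightarrow> int) \<Rightarrow> (int \<Rightarrow> int) \<Rightarrow> int \<Rightarrow> bool" where
  "halts_after b b' k \<longleftrightarrow>
     0 \<le> k \<and>
     (\<forall>i. 0 \<le> i \<and> i < k \<longrightarrow> round_step b b' i) \<and>
     (\<forall>i. 0 \<le> i \<and> i < k - 1 \<longrightarrow> quotient b i = quotient b' i) \<and>
     ((b k = 0 \<or> b' k = 0) \<or> (0 < k \<and> quotient b (k - 1) \<noteq> quotient b' (k - 1)))"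

end

theory Submission
  imports Defs
begin

text \<open>
  Both coordinates of the pair \<open>(b i, b' i)\<close> obey one linear recurrence, hence so does
  \<open>(a2 * b' i - a1 * b i) / a3\<close>, whose values alternate in sign, and the determinant of two
  consecutive pairs is \<open>a3\<close> up to sign. So on halting one has, for either parity of \<open>k\<close>,
  relations \<open>a1 * x = a2 * v + a3 * t\<close> and \<open>a2 * y = a1 * u + a3 * s\<close> with \<open>x * y - u * v = a3\<close>.
  The vectors \<open>(x, -v)\<close> and \<open>(-u, y)\<close> are then a basis of the lattice of all \<open>(p, q)\<close> with
  \<open>a3\<close> dividing \<open>a1 * p + a2 * q\<close>, and the halting condition makes the rectangle
  \<open>[1, x] \<times> [1, y]\<close> without its upper right corner of size \<open>u \<times> v\<close> a set of
  representatives that minimise \<open>a1 * p + a2 * q\<close> in each residue class. The largest of these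
  minima, which is \<open>G\<close>, is attained at one of the two outer corners of this L-shape.
\<close>

section \<open>\<open>G\<close> from two relations with determinant \<open>a3\<close>\<close>

lemma positively_representable_swap:
  "positively_representable a1 a2 a3 n \<longleftrightarrow> positively_representable a2 a1 a3 n"
  unfolding positively_representable_def by (metis add.commute)

locale lattice_relations =
  fixes a1 a2 a3 x y u v s t :: int
  assumes pos: "0 < a1" "0 < a2" "0 < a3"
    and coprime: "coprime a1 a2"
    and nonneg: "0 \<le> x" "0 \<le> y" "0 \<le> u" "0 \<le> v"
    and coeff_pos: "0 < s" "0 < t"
    and rel1: "a1 * x = a2 * v + a3 * t"
    and rel2: "a2 * y = a1 * u + a3 * s"
    and det: "x * y - u * v = a3"
begin

text \<open>The two coordinates play symmetric roles, so each one-sided result below has a mirror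
  image.\<close>

lemma swap: "lattice_relations a2 a1 a3 y x v u t s"
  using pos coprime nonneg coeff_pos rel1 rel2 det
  by unfold_locales (simp_all add: coprime_commute mult.commute)

lemma bezout:
  obtains c d where "a1 * c + a2 * d = 1"
  using coprime bezout_int[of a1 a2] that by (auto simp: coprime_iff_gcd_eq_1 mult.commute)

text \<open>This is the Cramer numerator of the coefficient of \<open>(p, q)\<close> along
  \<open>(x, -v)\<close>. By \<open>rel2\<close>, \<open>a3\<close> divides both its
  \<open>a1\<close>-fold and its \<open>a2\<close>-fold; Bezout removes these factors.\<close>

lemma dvd_first_coordinate:
  assumes "a3 dvd a1 * p + a2 * q"
  shows "a3 dvd y * p + u * q"
proof -
  have "a2 * (y * p + u * q) = u * (a1 * p + a2 * q) + a3 * (s * p)"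
    using arg_cong[OF rel2, of "\<lambda>w. w * p"] by (simp add: algebra_simps)
  hence *: "a3 dvd a2 * (y * p + u * q)"
    using assms by simp
  have "a1 * (y * p + u * q) = y * (a1 * p + a2 * q) - a3 * (s * q)"
    using arg_cong[OF rel2, of "\<lambda>w. w * q"] by (simp add: algebra_simps)
  hence **: "a3 dvd a1 * (y * p + u * q)"
    using assms by simp
  obtain c d where "a1 * c + a2 * d = 1"
    using bezout .
  hence "y * p + u * q = c * (a1 * (y * p + u * q)) + d * (a2 * (y * p + u * q))"
    by algebra
  also have "a3 dvd \<dots>"
    using dvd_add[OF dvd_mult[OF **] dvd_mult[OF *]] .
  finally show ?thesis .
qed

lemma lattice_basis:
  assumes "a3 dvd a1 * p + a2 * q"
  obtains i j where "p = i * x - j * u" and "q = j * y - i * v"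
proof -
  obtain i where i: "y * p + u * q = a3 * i"
    using dvd_first_coordinate[OF assms] by blast
  obtain j where j: "x * q + v * p = a3 * j"
    using lattice_relations.dvd_first_coordinate[OF swap, of q p] assms
    by (auto simp: add.commute)
  have "a3 * p = a3 * (i * x - j * u)"
    using i j det by algebra
  moreover have "a3 * q = a3 * (j * y - i * v)"
    using i j det by algebra
  ultimately show ?thesis
    using that pos by simp
qed

text \<open>The difference from the corner is an integer combination of the basis. Positivity of
  \<open>p\<close> and \<open>q\<close> forces both coefficients to be nonnegative, and each basis
  vector raises the value by a positive multiple of \<open>a3\<close>.\<close>

lemma corner_minimal:
  assumes "u \<le> x" "v \<le> y" "0 < p" "0 < q"
    and "a3 dvd a1 * (p - x) + a2 * (q - (y - v))"
  shows "a1 * x + a2 * (y - v) \<le> a1 * p + a2 * q"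
proof -
  obtain i j where ij: "p - x = i * x - j * u" "q - (y - v) = j * y - i * v"
    using lattice_basis[OF assms(5)] .
  have p: "u * j < x * (i + 1)" and q: "v * (i + 1) < y * (j + 1)"
    using ij assms(3,4) by (simp_all add: algebra_simps)
  have i: "0 \<le> i"
  proof (rule ccontr)
    \<comment> \<open>A negative \<open>i\<close> makes \<open>j\<close> negative by
      \<open>p\<close>; then \<open>q\<close> with \<open>v \<le> y\<close> gives
      \<open>i < j\<close>, and \<open>u \<le> x\<close> turns this into a contradiction to
      \<open>p\<close>.\<close>
    assume neg: "\<not> 0 \<le> i"
    hence "x * (i + 1) \<le> 0"
      using nonneg(1) by (simp add: mult_nonneg_nonpos)
    with p nonneg(3) have "j < 0"
      by (smt (verit) mult_nonneg_nonneg)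
    have "y * (i + 1) \<le> v * (i + 1)"
      using assms(2) neg by (simp add: mult_right_mono_neg)
    with q have "y * (i + 1) < y * (j + 1)" by linarith
    hence "i < j"
      using nonneg(2) by (simp add: mult_less_cancel_left)
    hence "x * (i + 1) \<le> x * j"
      using nonneg(1) by (simp add: mult_left_mono)
    moreover have "x * j \<le> u * j"
      using assms(1) \<open>j < 0\<close> by (simp add: mult_right_mono_neg)
    ultimately show False using p by linarith
  qed
  hence "0 \<le> v * (i + 1)" using nonneg(4) by simp
  with q have "0 < y * (j + 1)" by linarith
  hence "0 \<le> j"
    using nonneg(2) by (auto simp: zero_less_mult_iff)
  have "a1 * p + a2 * q - (a1 * x + a2 * (y - v)) = a1 * (p - x) + a2 * (q - (y - v))"
    by (simp add: algebra_simps)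
  also have "\<dots> = a3 * (i * t + j * s)"
    unfolding ij using rel1 rel2 by algebra
  also have "\<dots> \<ge> 0"
    using i \<open>0 \<le> j\<close> pos coeff_pos by simp
  finally show ?thesis by simp
qed

lemma corner_not_representable:
  assumes "u \<le> x" "v \<le> y"
  shows "\<not> positively_representable a1 a2 a3 (a1 * x + a2 * (y - v))"
proof
  assume "positively_representable a1 a2 a3 (a1 * x + a2 * (y - v))"
  then obtain p q r where pqr: "0 < p" "0 < q" "0 < r"
    and eq: "a1 * x + a2 * (y - v) = a1 * p + a2 * q + a3 * r"
    unfolding positively_representable_def by blast
  have "a1 * (p - x) + a2 * (q - (y - v)) = a3 * (- r)"
    using eq by (simp add: algebra_simps)
  hence "a1 * x + a2 * (y - v) \<le> a1 * p + a2 * q"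
    using corner_minimal[OF assms pqr(1,2)] by simp
  moreover have "0 < a3 * r" using pos pqr by simp
  ultimately show False using eq by linarith
qed

lemma residue_class_inhabited:
  obtains p q where "0 < p" "0 < q" "a3 dvd n - (a1 * p + a2 * q)"
proof -
  obtain c d where cd: "a1 * c + a2 * d = 1"
    using bezout .
  \<comment> \<open>The extra \<open>a3\<close> keeps the residue class and makes the coordinate
    positive.\<close>
  define p where "p = (n * c) mod a3 + a3"
  define q where "q = (n * d) mod a3 + a3"
  have "a3 dvd n * c - p" "a3 dvd n * d - q"
    unfolding p_def q_def by (simp_all add: minus_mod_eq_mult_div[symmetric] diff_diff_eq[symmetric])
  hence "a3 dvd a1 * (n * c - p) + a2 * (n * d - q)" by simp
  also have "a1 * (n * c - p) + a2 * (n * d - q) = n - (a1 * p + a2 * q)"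
    using cd by algebra
  finally show ?thesis
    using that[of p q] pos by (simp add: p_def q_def add_nonneg_pos)
qed

text \<open>A pair of least value in the residue class of \<open>n\<close> lies in the L-shape, so
  its value is at most that of the larger outer corner. Hence \<open>n\<close> exceeds it by a
  positive multiple of \<open>a3\<close>.\<close>

lemma representable_above_corners:
  assumes "a1 * x + a2 * y - min (a1 * u) (a2 * v) < n"
  shows "positively_representable a1 a2 a3 n"
proof -
  define Q where "Q = (\<lambda>(p, q). 0 < p \<and> 0 < q \<and> a3 dvd n - (a1 * p + a2 * q))"
  define val where "val = (\<lambda>(p, q). a1 * p + a2 * q)"
  obtain p0 q0 where "0 < p0" "0 < q0" "a3 dvd n - (a1 * p0 + a2 * q0)"
    by (rule residue_class_inhabited)
  hence "Q (p0, q0)"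
    by (simp add: Q_def)
  then obtain z where "Q z"
    and least_z: "\<forall>z'. Q z' \<longrightarrow> nat (val z) \<le> nat (val z')"
    using ex_has_least_nat[of Q _ "\<lambda>z. nat (val z)"] by blast
  obtain p q where "z = (p, q)"
    by (cases z)
  with \<open>Q z\<close> least_z have Q: "Q (p, q)"
    and least: "\<And>p' q'. Q (p', q') \<Longrightarrow> nat (a1 * p + a2 * q) \<le> nat (a1 * p' + a2 * q')"
    by (auto simp: val_def)
  have pq: "0 < p" "0 < q" "a3 dvd n - (a1 * p + a2 * q)"
    using Q by (simp_all add: Q_def)
  have no_descent: "\<not> (0 < p' \<and> 0 < q')"
    if "a1 * p + a2 * q = a1 * p' + a2 * q' + a3 * r" "0 < r" for p' q' r
  proof
    assume pos': "0 < p' \<and> 0 < q'"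
    have "n - (a1 * p' + a2 * q') = n - (a1 * p + a2 * q) + a3 * r"
      using that(1) by simp
    also have "a3 dvd \<dots>"
      using pq(3) by simp
    finally have "Q (p', q')"
      using pos' by (simp add: Q_def)
    hence "nat (a1 * p + a2 * q) \<le> nat (a1 * p' + a2 * q')"
      by (rule least)
    moreover have "0 < a1 * p' + a2 * q'"
      using pos pos' by (simp add: add_pos_pos)
    moreover have "0 < a3 * r"
      using pos that(2) by simp
    ultimately show False using that(1) by linarith
  qed
  \<comment> \<open>Subtracting \<open>(x, -v)\<close>, \<open>(-u, y)\<close> or their sum lowers
    the value by \<open>a3 * t\<close>, \<open>a3 * s\<close> or \<open>a3 * (s + t)\<close>, so by
    minimality the result must leave the positive quadrant.\<close>
  have px: "p \<le> x"
    using no_descent[of "p - x" "q + v" t] rel1 coeff_pos pq nonneg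
    by (simp add: algebra_simps)
  have qy: "q \<le> y"
    using no_descent[of "p + u" "q - y" s] rel2 coeff_pos pq nonneg
    by (simp add: algebra_simps)
  have "\<not> (x - u < p \<and> y - v < q)"
    using no_descent[of "p - (x - u)" "q - (y - v)" "s + t"] rel1 rel2 coeff_pos
    by (simp add: algebra_simps)
  hence "a1 * p + a2 * q \<le> a1 * x + a2 * y - min (a1 * u) (a2 * v)"
  proof (cases "p \<le> x - u")
    case True
    hence "a1 * p \<le> a1 * (x - u)" "a2 * q \<le> a2 * y"
      using qy pos by simp_all
    thus ?thesis by (simp add: algebra_simps)
  next
    case False
    with \<open>\<not> (x - u < p \<and> y - v < q)\<close> have "a1 * p \<le> a1 * x" "a2 * q \<le> a2 * (y - v)"
      using px pos by simp_all
    thus ?thesis by (simp add: algebra_simps)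
  qed
  with assms have less: "0 < n - (a1 * p + a2 * q)" by linarith
  obtain r where r: "n - (a1 * p + a2 * q) = a3 * r" using pq(3) by blast
  with less pos have "0 < r" by (simp add: zero_less_mult_iff)
  moreover have "n = a1 * p + a2 * q + a3 * r" using r by simp
  ultimately show ?thesis
    unfolding positively_representable_def using pq by blast
qed

lemma G_eq_of_le:
  assumes "u \<le> x" "v \<le> y"
  shows "G a1 a2 a3 = a1 * x + a2 * y - min (a1 * u) (a2 * v)"
  unfolding G_def
proof (rule Greatest_equality)
  have 1: "\<not> positively_representable a1 a2 a3 (a1 * x + a2 * (y - v))"
    using corner_not_representable assms .
  have "\<not> positively_representable a2 a1 a3 (a2 * y + a1 * (x - u))"
    using lattice_relations.corner_not_representable[OF swap] assms by simp
  hence 2: "\<not> positively_representable a1 a2 a3 (a1 * (x - u) + a2 * y)"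
    by (simp add: positively_representable_swap[of a1] add.commute)
  \<comment> \<open>The minimum selects the outer corner of larger value: \<open>(x - u, y)\<close>
    or \<open>(x, y - v)\<close>.\<close>
  show "\<not> positively_representable a1 a2 a3 (a1 * x + a2 * y - min (a1 * u) (a2 * v))"
    using 1 2 by (cases "a1 * u \<le> a2 * v") (simp_all add: algebra_simps min_def)
next
  fix n
  assume "\<not> positively_representable a1 a2 a3 n"
  thus "n \<le> a1 * x + a2 * y - min (a1 * u) (a2 * v)"
    using representable_above_corners not_less by blast
qed

text \<open>If \<open>u = 0\<close>, adding multiples of \<open>(0, y)\<close> to \<open>(x, -v)\<close> reduces \<open>v\<close> below \<open>y\<close>.\<close>

lemma G_eq_if_u_zero:
  assumes "u = 0"
  shows "G a1 a2 a3 = a1 * x + a2 * y"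
proof -
  have xy: "0 < y" "0 < x"
    using det pos nonneg assms by (auto simp: zero_less_mult_iff order_le_less)
  have red: "a1 * x = a2 * (v mod y) + a3 * (t + s * (v div y))"
  proof -
    have "a2 * v = a2 * (v mod y) + a2 * y * (v div y)"
      by (simp add: algebra_simps flip: distrib_left)
    thus ?thesis
      using rel1 rel2 assms by (simp add: algebra_simps)
  qed
  interpret r: lattice_relations a1 a2 a3 x y u "v mod y" s "t + s * (v div y)"
    using pos coprime nonneg coeff_pos red rel2 det assms xy
    by unfold_locales (auto simp: pos_imp_zdiv_nonneg_iff intro: add_pos_nonneg)
  show ?thesis
    using r.G_eq_of_le xy assms pos by (simp add: pos_mod_bound less_imp_le)
qed

text \<open>The last two alternatives cover halting at a zero remainder, where the order may fail
  but the minimum is 0.\<close>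

lemma G_eq:
  assumes "u \<le> x \<and> v \<le> y \<or> u = 0 \<or> v = 0"
  shows "G a1 a2 a3 = a1 * x + a2 * y - min (a1 * u) (a2 * v)"
proof -
  consider "u \<le> x" "v \<le> y" | "u = 0" | "v = 0"
    using assms by blast
  thus ?thesis
  proof cases
    case 1
    thus ?thesis by (rule G_eq_of_le)
  next
    case 2
    thus ?thesis
      using G_eq_if_u_zero pos nonneg by simp
  next
    case 3
    have "G a1 a2 a3 = G a2 a1 a3"
      unfolding G_def positively_representable_swap[of a1] ..
    also have "\<dots> = a2 * y + a1 * x"
      using lattice_relations.G_eq_if_u_zero[OF swap] 3 .
    finally show ?thesis
      using 3 pos nonneg by simp
  qed
qed

end

section \<open>The invariant of the procedure\<close>

text \<open>Used with \<open>(c, c') = (b (i - 1), b' (i - 1))\<close>, \<open>(d, d') = (b i, b' i)\<close> and the sign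
  \<open>e = (-1) ^ i\<close>.\<close>

definition linked ::
  "int \<Rightarrow> int \<Rightarrow> int \<Rightarrow> int \<Rightarrow> int \<Rightarrow> int \<Rightarrow> int \<Rightarrow> int \<Rightarrow> int \<Rightarrow> int \<Rightarrow> bool" where
  "linked a1 a2 a3 e c c' d d' s t \<longleftrightarrow>
     0 \<le> c \<and> 0 \<le> c' \<and> 0 \<le> d \<and> 0 \<le> d' \<and> 0 < s \<and> 0 \<le> t \<and>
     c * d' - d * c' = e * a3 \<and>
     a2 * d' - a1 * d = e * (a3 * s) \<and> a2 * c' - a1 * c = - (e * (a3 * t))"

text \<open>Since \<open>m\<close> is at most both quotients, the new entries stay nonnegative;
  since \<open>m\<close> is at least 1, \<open>t + m * s\<close> is positive. The determinant only
  changes sign.\<close>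

lemma linked_step:
  assumes linked: "linked a1 a2 a3 e c c' d d' s t"
    and pos: "0 < d" "0 < d'" and le: "d \<le> c" "d' \<le> c'"
    and m: "m = min (c div d) (c' div d')"
  shows "linked a1 a2 a3 (- e) d d' (c - m * d) (c' - m * d') (t + m * s) s"
proof -
  have "1 \<le> c div d" "1 \<le> c' div d'"
    using pos le by (simp_all add: pos_imp_zdiv_pos_iff int_one_le_iff_zero_less)
  hence "1 \<le> m" using m by simp
  moreover have "m * d \<le> c div d * d" "m * d' \<le> c' div d' * d'"
    using pos m by (simp_all add: mult_right_mono)
  hence "m * d \<le> c" "m * d' \<le> c'"
    using pos pos_mod_sign[of d c] pos_mod_sign[of d' c'] div_mult_mod_eq[of c d] div_mult_mod_eq[of c' d']
    by linarith+
  moreover have "d * (c' - m * d') - (c - m * d) * d' = - e * a3"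
    "a2 * (c' - m * d') - a1 * (c - m * d) = - e * (a3 * (t + m * s))"
    "a2 * d' - a1 * d = - (- e * (a3 * s))"
    using linked unfolding linked_def by algebra+
  ultimately show ?thesis
    using linked unfolding linked_def by (simp add: add_nonneg_pos)
qed

lemma procedure_invariant:
  fixes a1 a2 a3 :: int and b b' :: "int \<Rightarrow> int" and n :: nat
  assumes pos: "0 < a1" "0 < a2" "0 < a3"
    and init: "initial_values a1 a2 a3 b b'" "0 < b 0"
    and steps: "\<And>i. 0 \<le> i \<Longrightarrow> i < int n \<Longrightarrow> round_step b b' i \<and> quotient b i = quotient b' i"
  shows "b n \<le> b (int n - 1) \<and> b' n \<le> b' (int n - 1) \<and>
    (\<exists>s t. linked a1 a2 a3 ((-1) ^ n) (b (int n - 1)) (b' (int n - 1)) (b n) (b' n) s t)"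
  using steps
proof (induction n)
  case 0
  have "a1 * b 0 < a2 * b' 0"
    using init pos by (simp add: initial_values_def)
  also have "\<dots> \<le> a2 * a1"
    using init pos by (simp add: initial_values_def)
  finally have "b 0 < a2"
    using pos by (simp add: mult.commute)
  \<comment> \<open>The starting pair \<open>(a2, a1)\<close> has value 0 and
    \<open>(b 0, b' 0)\<close> has value \<open>a3\<close>, hence \<open>t = 0\<close> and
    \<open>s = 1\<close>.\<close>
  moreover from this have "linked a1 a2 a3 1 a2 a1 (b 0) (b' 0) 1 0"
    using init pos by (auto simp: initial_values_def linked_def)
  ultimately show ?case
    using init by (auto simp: initial_values_def)
next
  case (Suc n)
  define m where "m = min (quotient b n) (quotient b' n)"
  have step: "round_step b b' n" "quotient b n = m" "quotient b' n = m"
    using Suc.prems[of n] by (simp_all add: m_def)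
  obtain s t where IH: "b n \<le> b (int n - 1)" "b' n \<le> b' (int n - 1)"
    "linked a1 a2 a3 ((-1) ^ n) (b (int n - 1)) (b' (int n - 1)) (b n) (b' n) s t"
    using Suc.IH[OF Suc.prems] by auto
  have nz: "0 < b n" "0 < b' n"
    using IH(3) step by (auto simp: round_step_def linked_def)
  have next_b: "b (int n + 1) = b (int n - 1) - m * b n"
    "b' (int n + 1) = b' (int n - 1) - m * b' n"
    using step(1) unfolding m_def by (simp_all add: round_step_def Let_def)
  \<comment> \<open>Equal quotients make both subtractions full Euclidean divisions, so both
    sequences decrease.\<close>
  have "b (int n + 1) = b (int n - 1) mod b n" "b' (int n + 1) = b' (int n - 1) mod b' n"
    using step(2,3) minus_div_mult_eq_mod[of "b (int n - 1)" "b n"]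
      minus_div_mult_eq_mod[of "b' (int n - 1)" "b' n"]
    by (simp_all add: next_b quotient_def)
  hence "b (int n + 1) \<le> b n" "b' (int n + 1) \<le> b' n"
    using nz by (simp_all add: less_imp_le)
  moreover have "linked a1 a2 a3 (- ((-1) ^ n)) (b n) (b' n) (b (int n + 1)) (b' (int n + 1)) (t + m * s) s"
    unfolding next_b using linked_step[OF IH(3) nz IH(1,2)] by (simp add: m_def quotient_def)
  ultimately show ?case
    by (auto simp: add.commute)
qed

text \<open>Subtracting the smaller quotient leaves a true remainder in one coordinate and at least
  one whole divisor in the other.\<close>

lemma remainder_bounds_if_quotients_differ:
  fixes c d c' d' :: int
  assumes "0 < d" "0 < d'" "c div d < c' div d'"
  shows "c - c div d * d < d" "d' \<le> c' - c div d * d'"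
proof -
  show "c - c div d * d < d"
    using assms by (simp add: minus_div_mult_eq_mod)
  have "(c div d + 1) * d' \<le> c' div d' * d'"
    using assms by (intro mult_right_mono) auto
  also have "\<dots> \<le> c'"
    using assms pos_mod_sign[of d' c'] div_mult_mod_eq[of c' d'] by linarith
  finally show "d' \<le> c' - c div d * d'"
    by (simp add: algebra_simps)
qed

section \<open>The relations at the halting index\<close>

theorem theorem10:
  fixes a1 a2 a3 k :: int and b b' :: "int \<Rightarrow> int"
  assumes "0 < a1" and "a1 < a2" and "a2 < a3"
    and "gcd a1 a2 = 1"
    and "initial_values a1 a2 a3 b b'"
    and "b 0 > 0"
    and "halts_after b b' k"
  shows "G a1 a2 a3 =
    (if odd k
     then b k * a1 + b' (k - 1) * a2 - min (b (k - 1) * a1) (b' k * a2)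
     else b (k - 1) * a1 + b' k * a2 - min (b k * a1) (b' (k - 1) * a2))"
proof -
  have pos: "0 < a1" "0 < a2" "0 < a3"
    using assms(1-3) by auto
  \<comment> \<open>Both \<open>b 0\<close> and \<open>b' 0\<close> are positive, so the zero test
    fails at index 0.\<close>
  have "0 < k"
    using assms(5-7) by (cases "k = 0") (auto simp: halts_after_def initial_values_def)
  then obtain n where k: "k = int n + 1"
    by (metis add.commute zero_less_imp_eq_int of_nat_Suc gr0_implies_Suc)
  define c c' d d' where "c = b (int n - 1)" and "c' = b' (int n - 1)" and "d = b n" and "d' = b' n"
  define m where "m = min (c div d) (c' div d')"
  define e :: int where "e = (-1) ^ n"
  have step: "round_step b b' n"
    using assms(7) k by (simp add: halts_after_def)
  have bk: "b k = c - m * d" "b' k = c' - m * d'"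
    using step k by (simp_all add: round_step_def Let_def m_def quotient_def c_def c'_def d_def d'_def)
  have stop: "b k = 0 \<or> b' k = 0 \<or> c div d \<noteq> c' div d'"
    using assms(7) k by (auto simp: halts_after_def quotient_def c_def c'_def d_def d'_def)
  obtain s t where le: "d \<le> c" "d' \<le> c'" and linked: "linked a1 a2 a3 e c c' d d' s t"
    using procedure_invariant[OF pos assms(5,6), of n] assms(7) k
    by (auto simp: halts_after_def c_def c'_def d_def d'_def e_def)
  have nz: "0 < d" "0 < d'"
    using linked step by (auto simp: linked_def round_step_def d_def d'_def)
  define s' where "s' = t + m * s"
  have final: "linked a1 a2 a3 (- e) d d' (b k) (b' k) s' s"
    unfolding bk s'_def using linked_step[OF linked nz le m_def] .
  have "0 < s"
    using linked by (simp add: linked_def)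
  have order: "b k \<le> d \<and> d' \<le> b' k \<or> d \<le> b k \<and> b' k \<le> d' \<or> b k = 0 \<or> b' k = 0"
    using stop remainder_bounds_if_quotients_differ[OF nz, of c c']
      remainder_bounds_if_quotients_differ[OF nz(2,1), of c' c]
    unfolding bk m_def by (cases "c div d" "c' div d'" rule: linorder_cases) auto
  have prev: "b (k - 1) = d" "b' (k - 1) = d'"
    by (simp_all add: k d_def d'_def)
  have cop: "coprime a1 a2"
    using assms(4) by (simp add: coprime_iff_gcd_eq_1)
  show ?thesis
  proof (cases "odd k")
    case True
    hence "e = 1" by (simp add: k e_def)
    with final have rels: "b k * d' - d * b' k = a3" "a1 * b k = a2 * b' k + a3 * s'"
      "a2 * d' = a1 * d + a3 * s"
      by (simp_all add: linked_def algebra_simps)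
    interpret lattice_relations a1 a2 a3 "b k" d' d "b' k" s s'
      using pos cop final rels \<open>0 < s\<close> by unfold_locales (auto simp: linked_def)
    \<comment> \<open>The positive determinant rules out \<open>b k = 0\<close> and the opposite
      order.\<close>
    have "d \<le> b k \<and> b' k \<le> d' \<or> d = 0 \<or> b' k = 0"
    proof -
      have "0 \<le> d * b' k"
        using nz nonneg by simp
      hence "b k \<noteq> 0"
        using rels(1) pos by auto
      moreover have "d * b' k < b k * d'"
        using rels(1) pos by simp
      hence "\<not> (b k \<le> d \<and> d' \<le> b' k)"
        using nz nonneg mult_mono[of "b k" d d' "b' k"] by auto
      ultimately show ?thesis using order by blast
    qed
    thus ?thesis
      using G_eq True by (simp add: prev mult.commute)
  next
    case False
    hence "e = -1" by (simp add: k e_def)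
    with final have rels: "d * b' k - b k * d' = a3" "a1 * d = a2 * d' + a3 * s"
      "a2 * b' k = a1 * b k + a3 * s'"
      by (simp_all add: linked_def algebra_simps)
    interpret lattice_relations a1 a2 a3 d "b' k" "b k" d' s' s
      using pos cop final rels \<open>0 < s\<close> by unfold_locales (auto simp: linked_def)
    \<comment> \<open>For even \<open>k\<close> the determinant has the other sign and rules out
      \<open>b' k = 0\<close> instead.\<close>
    have "b k \<le> d \<and> d' \<le> b' k \<or> b k = 0 \<or> d' = 0"
    proof -
      have "0 \<le> b k * d'"
        using nz nonneg by simp
      hence "b' k \<noteq> 0"
        using rels(1) pos by auto
      moreover have "b k * d' < d * b' k"
        using rels(1) pos by simp
      hence "\<not> (d \<le> b k \<and> b' k \<le> d')"
        using nz nonneg mult_mono[of d "b k" "b' k" d'] by auto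
      ultimately show ?thesis using order by blast
    qed
    thus ?thesis
      using G_eq False by (simp add: prev mult.commute)
  qed
qed

end
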